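(* Let $\mathcal{K}$ and $\mathcal{V}$ satisfy (A0) and (A1) as given in the context, let $V_1,\ldots,V_k$ be $b$-subsemimodules of $\mathcal{V}$, and for every integer $i\ge1$ let $V_i$ and $P_i=P_{V_i}$ be defined by cyclic numbering, $V_{i+k}=V_i$, $P_{i+k}=P_i$. Suppose that the vectors $x^i\in\mathcal{V}$, $i=1,2,\ldots$, are such that $x^1\in V_1$ and $x^i=P_ix^{i-1}$ for $i=2,3,\ldots$. Then $d_{\mathrm H}(x^{l+1},\ldots,x^{l+k})$ is nondecreasing with $l$, $l=0,1,2,\ldots$, so that the following inequalities hold for all $l$: $$d_{\mathrm H}(x^1,\ldots,x^k)\le d_{\mathrm H}(x^{l+1},\ldots,x^{l+k})\le\mathbf{1}.$$
   Context: Setting. A semiring $\mathcal{K}$ (zero $\mathbf{0}$, unit $\mathbf{1}\neq\mathbf{0}$) is idempotent if $a\oplus a=a$ for all $a$. On $\mathcal{K}$ and on a semimodule $\mathcal{V}$ over $\mathcal{K}$ (whose zero is also denoted $\mathbf{0}$), the canonical partial order is $a\le b\Leftrightarrow a\oplus b=b$, so $\oplus$ is the binary supremum. A semiring or semimodule is $b$-complete if every subset bounded from above has a supremum and multiplication distributes over such suprema (for a semimodule: scalar multiplication distributes over suprema of bounded sets of vectors and over suprema of bounded sets of scalars). An idempotent semifield is an idempotent semiring $\mathcal{K}$ in which $\mathcal{K}\setminus\{\mathbf{0}\}$ is an abelian group under multiplication. (A0): $\mathcal{K}$ is a $b$-complete idempotent semifield and $\mathcal{V}$ is a $b$-complete semimodule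 over $\mathcal{K}$. (A1): for all $x\in\mathcal{V}$ and $y\in\mathcal{V}\setminus\{\mathbf{0}\}$, the set $\{\lambda\in\mathcal{K}\mid\lambda y\le x\}$ is bounded from above. For $x\in\mathcal{V}$ and $y\in\mathcal{V}\setminus\{\mathbf{0}\}$ put $x/y=\max\{\lambda\in\mathcal{K}\mid \lambda y\le x\}$ (the maximum exists). A $b$-subsemimodule $V$ of $\mathcal{V}$ is a subsemimodule closed under suprema of its subsets that are bounded from above in $\mathcal{V}$. The projector onto it is $P_V(x)=\max\{u\in V\mid u\le x\}$, $x\in\mathcal{V}$. The Hilbert value of nonzero $x^1,\ldots,x^k\in\mathcal{V}$ is $d_{\mathrm H}(x^1,\ldots,x^k)=(x^1/x^2)(x^2/x^3)\cdots(x^{k-1}/x^k)(x^k/x^1)$; by convention it equals $\mathbf{0}$ if some $x^i=\mathbf{0}$. *)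

theory Defs
  imports Complex_Main "HOL-Library.Lub_Glb"
begin

class idempotent_comm_monoid_add = comm_monoid_add + order +
  assumes add_idem: "a + a = a"
    and canonical_le: "a \<le> b \<longleftrightarrow> a + b = b"

text \<open>The superclass \<^class>\<open>semiring_1\<close> includes absorption by zero and the
  axiom that zero and one are distinct.\<close>

class idempotent_semiring = semiring_1 + idempotent_comm_monoid_add

text \<open>Zero is absorbing and distinct from one, so multiplicative inverses are nonzero
  and the nonzero elements are closed under multiplication; with commutativity they form
  an abelian group.\<close>

class idempotent_semifield = idempotent_semiring + comm_semiring_1 +
  assumes nonzero_invertible: "a \<noteq> 0 \<Longrightarrow> \<exists>b. a * b = 1"

lemma idempotent_semifield_mult_nonzero:
  fixes a b :: "'a::idempotent_semifield"
  assumes "a \<noteq> 0" "b \<noteq> 0"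
  shows "a * b \<noteq> 0"
proof
  assume ab: "a * b = 0"
  obtain c where c: "a * c = 1"
    using nonzero_invertible[OF assms(1)] by blast
  have "b = (a * c) * b" by (simp add: c)
  also have "\<dots> = (a * b) * c" by (simp add: ac_simps)
  finally show False using ab assms(2) by simp
qed

locale idempotent_semimodule =
  fixes scale :: "'k::idempotent_semiring \<Rightarrow> 'v::idempotent_comm_monoid_add \<Rightarrow> 'v"
  assumes scale_add_right: "scale a (x + y) = scale a x + scale a y"
    and scale_add_left: "scale (a + b) x = scale a x + scale b x"
    and scale_scale: "scale a (scale b x) = scale (a * b) x"
    and scale_one: "scale 1 x = x"
    and scale_zero_left: "scale 0 x = 0"
    and scale_zero_right: "scale a 0 = 0"

text \<open>The scalars and the vectors are both required to be b-complete. Admitting the empty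
  set is harmless: its supremum is zero, which is absorbing. Multiplication of scalars is
  commutative, so one distributive law suffices for it.\<close>

locale b_complete_semimodule = idempotent_semimodule scale
  for scale :: "'k::idempotent_semifield \<Rightarrow> 'v::idempotent_comm_monoid_add \<Rightarrow> 'v" +
  assumes scalar_b_complete: "\<And>L :: 'k set. bdd_above L \<Longrightarrow> \<exists>l. isLub UNIV L l"
    and mult_distrib_isLub:
      "\<And>(L :: 'k set) l a. bdd_above L \<Longrightarrow> isLub UNIV L l \<Longrightarrow> isLub UNIV ((*) a ` L) (a * l)"
    and vector_b_complete: "\<And>X :: 'v set. bdd_above X \<Longrightarrow> \<exists>s. isLub UNIV X s"
    and scale_distrib_isLub_vector:
      "bdd_above X \<Longrightarrow> isLub UNIV X s \<Longrightarrow> isLub UNIV (scale a ` X) (scale a s)"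
    and scale_distrib_isLub_scalar:
      "bdd_above L \<Longrightarrow> isLub UNIV L l \<Longrightarrow> isLub UNIV ((\<lambda>a. scale a x) ` L) (scale l x)"

definition b_subsemimodule ::
  "('k::idempotent_semiring \<Rightarrow> 'v::idempotent_comm_monoid_add \<Rightarrow> 'v) \<Rightarrow> 'v set \<Rightarrow> bool" where
  "b_subsemimodule scale V \<longleftrightarrow>
     0 \<in> V \<and>
     (\<forall>x\<in>V. \<forall>y\<in>V. x + y \<in> V) \<and>
     (\<forall>a. \<forall>x\<in>V. scale a x \<in> V) \<and>
     (\<forall>X s. X \<subseteq> V \<longrightarrow> bdd_above X \<longrightarrow> isLub UNIV X s \<longrightarrow> s \<in> V)"

definition vec_quotient ::
  "('k::idempotent_semiring \<Rightarrow> 'v::idempotent_comm_monoid_add \<Rightarrow> 'v) \<Rightarrow> 'v \<Rightarrow> 'v \<Rightarrow> 'k" where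
  "vec_quotient scale x y = (GREATEST a. scale a y \<le> x)"

definition projector :: "'v::idempotent_comm_monoid_add set \<Rightarrow> 'v \<Rightarrow> 'v" where
  "projector V x = (GREATEST u. u \<in> V \<and> u \<le> x)"

text \<open>The vectors are listed from index 0; the successor index is taken modulo the length,
  so that the last factor is the last vector over the first.\<close>

definition hilbert_value ::
  "('k::idempotent_semifield \<Rightarrow> 'v::idempotent_comm_monoid_add \<Rightarrow> 'v) \<Rightarrow> 'v list \<Rightarrow> 'k" where
  "hilbert_value scale xs =
     (if 0 \<in> set xs then 0
      else \<Prod>i<length xs. vec_quotient scale (xs ! i) (xs ! (Suc i mod length xs)))"

end

theory Submission
  imports Defs
begin

text \<open>Let \<open>x\<close> be the orbit and consider the window starting at \<open>x\<^sup>n\<close>. Since \<open>x\<^sup>n\<close> and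
  \<open>x\<^bsup>n+k\<^esup>\<close> lie in the same subsemimodule and \<open>x\<^bsup>n+k\<^esup>\<close> is the largest element of it below
  \<open>x\<^bsup>n+k-1\<^esup>\<close>, we have \<open>x\<^bsup>n+k-1\<^esup>/x\<^sup>n \<le> x\<^bsup>n+k\<^esup>/x\<^sup>n\<close>. Together with
  \<open>(x\<^bsup>n+k\<^esup>/x\<^sup>n)(x\<^sup>n/x\<^bsup>n+1\<^esup>) \<le> x\<^bsup>n+k\<^esup>/x\<^bsup>n+1\<^esup>\<close> and \<open>1 \<le> x\<^bsup>n+k-1\<^esup>/x\<^bsup>n+k\<^esup>\<close>, this
  compares consecutive windows. For the upper bound, the product of quotients along a cycle
  is at most \<open>y/y\<close>, and \<open>y/y \<le> 1\<close>: if \<open>a y \<le> y\<close>, the powers of \<open>a\<close> are bounded, and their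
  supremum \<open>s\<close> satisfies \<open>a s \<le> s\<close>.\<close>

section \<open>Order in idempotent semirings and semifields\<close>

lemma zero_least:
  fixes a :: "'a::idempotent_comm_monoid_add"
  shows "0 \<le> a"
  by (simp add: canonical_le)

lemma le_zero_imp_eq:
  fixes a :: "'a::idempotent_comm_monoid_add"
  shows "a \<le> 0 \<Longrightarrow> a = 0"
  using zero_least by (rule antisym[rotated])

lemma semiring_mult_left_mono:
  fixes a b c :: "'a::idempotent_semiring"
  assumes "a \<le> b"
  shows "c * a \<le> c * b"
  using assms by (simp add: canonical_le flip: distrib_left)

lemma semiring_mult_right_mono:
  fixes a b c :: "'a::idempotent_semiring"
  assumes "a \<le> b"
  shows "a * c \<le> b * c"
  using assms by (simp add: canonical_le flip: distrib_right)

lemma semifield_mult_le_self_imp_le_one: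
  fixes a s :: "'a::idempotent_semifield"
  assumes "a * s \<le> s" "s \<noteq> 0"
  shows "a \<le> 1"
proof -
  obtain t where "s * t = 1"
    using nonzero_invertible[OF assms(2)] by blast
  then show ?thesis
    using semiring_mult_right_mono[OF assms(1), of t] by (simp add: mult.assoc)
qed

context idempotent_semimodule
begin

lemma scale_right_mono: "u \<le> v \<Longrightarrow> scale a u \<le> scale a v"
  by (simp add: canonical_le flip: scale_add_right)

lemma scale_left_mono: "a \<le> b \<Longrightarrow> scale a u \<le> scale b u"
  by (simp add: canonical_le flip: scale_add_left)

end

section \<open>Quotients and projectors under (A0) and (A1)\<close>

locale archimedean_b_complete_semimodule = b_complete_semimodule scale
  for scale :: "'k::idempotent_semifield \<Rightarrow> 'v::idempotent_comm_monoid_add \<Rightarrow> 'v" +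
  assumes bdd_above_quotient: "v \<noteq> 0 \<Longrightarrow> bdd_above {a. scale a v \<le> u}"
begin

abbreviation quot :: "'v \<Rightarrow> 'v \<Rightarrow> 'k" (infixl "\<oslash>" 70)
  where "quot \<equiv> vec_quotient scale"

lemma scale_eq_zero_imp:
  assumes "scale a v = 0" "v \<noteq> 0"
  shows "a = 0"
proof (rule ccontr)
  assume "a \<noteq> 0"
  then obtain b where "a * b = 1"
    using nonzero_invertible by blast
  then have "v = scale b (scale a v)"
    by (simp add: scale_scale scale_one mult.commute)
  then show False
    using assms by (simp add: scale_zero_right)
qed

text \<open>Residuation: scaling distributes over the supremum of the admissible scalars, so this
  supremum is itself admissible and the \<open>GREATEST\<close> in \<open>vec_quotient\<close> is
  attained. The equivalence replaces the definition from here on.\<close>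

lemma scale_le_iff_le_quotient:
  assumes "v \<noteq> 0"
  shows "scale a v \<le> u \<longleftrightarrow> a \<le> u \<oslash> v"
proof -
  let ?L = "{a. scale a v \<le> u}"
  obtain l where l: "isLub UNIV ?L l"
    using scalar_b_complete[OF bdd_above_quotient[OF assms]] by blast
  have "isLub UNIV ((\<lambda>a. scale a v) ` ?L) (scale l v)"
    using scale_distrib_isLub_scalar[OF bdd_above_quotient[OF assms] l] .
  then have le: "scale l v \<le> u"
    by (rule isLub_le_isUb) (auto intro!: isUbI setleI)
  have ub: "a \<le> l" if "scale a v \<le> u" for a
    using l that by (auto dest: isLubD2)
  have "u \<oslash> v = l"
    unfolding vec_quotient_def using le ub by (rule Greatest_equality)
  then show ?thesis
    using ub le scale_left_mono order_trans by metis
qed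

lemma scale_quotient_le: "v \<noteq> 0 \<Longrightarrow> scale (u \<oslash> v) v \<le> u"
  by (simp add: scale_le_iff_le_quotient)

lemma quotient_mult_le:
  assumes "v \<noteq> 0" "w \<noteq> 0"
  shows "(u \<oslash> v) * (v \<oslash> w) \<le> u \<oslash> w"
proof -
  have "scale ((u \<oslash> v) * (v \<oslash> w)) w = scale (u \<oslash> v) (scale (v \<oslash> w) w)"
    by (simp add: scale_scale)
  also have "\<dots> \<le> scale (u \<oslash> v) v"
    by (intro scale_right_mono scale_quotient_le assms)
  also have "\<dots> \<le> u"
    by (intro scale_quotient_le assms)
  finally show ?thesis
    using assms by (simp add: scale_le_iff_le_quotient)
qed

lemma one_le_quotient: "v \<noteq> 0 \<Longrightarrow> v \<le> u \<Longrightarrow> 1 \<le> u \<oslash> v"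
  by (simp add: scale_one flip: scale_le_iff_le_quotient)

lemma quotient_self_le_one:
  assumes "v \<noteq> 0"
  shows "v \<oslash> v \<le> 1"
proof -
  define a where "a = v \<oslash> v"
  have powers: "scale (a ^ n) v \<le> v" for n
  proof (induction n)
    case (Suc n)
    have "scale (a ^ Suc n) v = scale a (scale (a ^ n) v)"
      by (simp add: scale_scale)
    also have "\<dots> \<le> scale a v"
      using Suc by (rule scale_right_mono)
    also have "\<dots> \<le> v"
      unfolding a_def using assms by (rule scale_quotient_le)
    finally show ?case .
  qed (simp add: scale_one)
  \<comment> \<open>All powers lie in the set that (A1) bounds when both vectors are
    \<open>v\<close>.\<close>
  then have bdd: "bdd_above (range ((^) a))"
    by (intro bdd_above_mono[OF bdd_above_quotient[OF assms, of v]]) auto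
  then obtain s where s: "isLub UNIV (range ((^) a)) s"
    using scalar_b_complete by blast
  then have le_s: "a ^ n \<le> s" for n
    by (auto dest: isLubD2)
  have "isLub UNIV ((*) a ` range ((^) a)) (a * s)"
    using mult_distrib_isLub[OF bdd s] .
  \<comment> \<open>Multiplication by \<open>a\<close> turns each power into the next one, still
    below \<open>s\<close>.\<close>
  then have "a * s \<le> s"
    by (rule isLub_le_isUb) (auto intro!: isUbI setleI simp: le_s simp flip: power_Suc)
  \<comment> \<open>The zeroth power puts \<open>1\<close> below \<open>s\<close>, so
    \<open>s\<close> can be cancelled.\<close>
  moreover have "s \<noteq> 0"
    using le_s[of 0] le_zero_imp_eq[of "1::'k"] by auto
  ultimately show ?thesis
    unfolding a_def by (rule semifield_mult_le_self_imp_le_one)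
qed

text \<open>Closure under bounded suprema puts the supremum of the elements of \<open>V\<close>
  below \<open>u\<close> back into \<open>V\<close>, so the \<open>GREATEST\<close> in
  \<open>projector\<close> is attained.\<close>

lemma projector_greatest:
  assumes V: "b_subsemimodule scale V"
  shows projector_in: "projector V u \<in> V"
    and projector_le: "projector V u \<le> u"
    and le_projector: "v \<in> V \<Longrightarrow> v \<le> u \<Longrightarrow> v \<le> projector V u"
proof -
  let ?X = "{v. v \<in> V \<and> v \<le> u}"
  have bdd: "bdd_above ?X"
    by (rule bdd_aboveI[of _ u]) simp
  then obtain s where s: "isLub UNIV ?X s"
    using vector_b_complete by blast
  have "s \<in> V"
    using V s bdd by (auto simp: b_subsemimodule_def intro: bdd_aboveI elim!: allE[of _ ?X])
  moreover have "s \<le> u"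
    using s by (rule isLub_le_isUb) (auto intro!: isUbI setleI)
  moreover have ub: "v \<le> s" if "v \<in> V" "v \<le> u" for v
    using s that by (auto dest: isLubD2)
  ultimately have "projector V u = s"
    unfolding projector_def by (intro Greatest_equality) auto
  then show "projector V u \<in> V" "projector V u \<le> u"
    and "v \<in> V \<Longrightarrow> v \<le> u \<Longrightarrow> v \<le> projector V u"
    using \<open>s \<in> V\<close> \<open>s \<le> u\<close> ub by auto
qed

text \<open>The multiple of \<open>v\<close> by \<open>u \<oslash> v\<close> stays in
  \<open>V\<close> and below \<open>u\<close>, hence below the projection.\<close>

lemma quotient_le_quotient_projector:
  assumes "b_subsemimodule scale V" "v \<in> V" "v \<noteq> 0"
  shows "u \<oslash> v \<le> projector V u \<oslash> v"
proof -
  have "scale (u \<oslash> v) v \<in> V"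
    using assms unfolding b_subsemimodule_def by blast
  then have "scale (u \<oslash> v) v \<le> projector V u"
    using assms by (intro le_projector scale_quotient_le)
  then show ?thesis
    using assms by (simp add: scale_le_iff_le_quotient)
qed

lemma quotient_zero:
  assumes "v \<noteq> 0"
  shows "0 \<oslash> v = 0"
  using scale_eq_zero_imp[OF le_zero_imp_eq[OF scale_quotient_le[OF assms]] assms] .

text \<open>Telescoping by \<open>quotient_mult_le\<close>, starting from
  \<open>1 \<le> y 0 \<oslash> y 0\<close>.\<close>

lemma prod_quotient_le:
  assumes "\<And>i. i \<le> m \<Longrightarrow> y i \<noteq> 0"
  shows "(\<Prod>i<m. y i \<oslash> y (Suc i)) \<le> y 0 \<oslash> y m"
  using assms
proof (induction m)
  case 0
  then show ?case
    by (simp add: one_le_quotient)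
next
  case (Suc m)
  then have "(\<Prod>i<m. y i \<oslash> y (Suc i)) * (y m \<oslash> y (Suc m))
      \<le> (y 0 \<oslash> y m) * (y m \<oslash> y (Suc m))"
    by (intro semiring_mult_right_mono) auto
  also have "\<dots> \<le> y 0 \<oslash> y (Suc m)"
    using Suc.prems by (intro quotient_mult_le) auto
  finally show ?case
    by simp
qed

section \<open>Hilbert values of consecutive windows\<close>

lemma hilbert_value_window:
  assumes "\<And>i. i \<le> m \<Longrightarrow> y (n + i) \<noteq> 0"
  shows "hilbert_value scale (map y [n..<n + Suc m]) =
    (\<Prod>i<m. y (n + i) \<oslash> y (n + Suc i)) * (y (n + m) \<oslash> y n)"
proof -
  have "0 \<notin> set (map y [n..<n + Suc m])"
  proof
    assume "0 \<in> set (map y [n..<n + Suc m])"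
    then obtain j where "n \<le> j" "j < n + Suc m" "y j = 0"
      by (auto simp del: upt_Suc)
    then show False
      using assms[of "j - n"] by (simp add: le_diff_conv less_Suc_eq_le add.commute)
  qed
  then have "hilbert_value scale (map y [n..<n + Suc m]) =
      (\<Prod>i<Suc m. map y [n..<n + Suc m] ! i \<oslash> map y [n..<n + Suc m] ! (Suc i mod Suc m))"
    by (simp add: hilbert_value_def del: upt_Suc prod.lessThan_Suc)
  also have "\<dots> = (\<Prod>i<Suc m. y (n + i) \<oslash> y (n + (Suc i mod Suc m)))"
    by (intro prod.cong) (auto simp: nth_map_upt simp del: upt_Suc)
  \<comment> \<open>Only the factor \<open>i = m\<close> wraps around, since
    \<open>Suc m mod Suc m\<close> is \<open>0\<close>; it closes the cycle at
    \<open>y n\<close>.\<close>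
  also have "\<dots> = (\<Prod>i<m. y (n + i) \<oslash> y (n + Suc i)) * (y (n + m) \<oslash> y n)"
    by simp
  finally show ?thesis .
qed

lemma hilbert_value_zero:
  assumes "i \<le> m" "y (n + i) = 0"
  shows "hilbert_value scale (map y [n..<n + Suc m]) = 0"
proof -
  have "0 \<in> y ` {n..<n + Suc m}"
    using assms by (intro image_eqI[of _ _ "n + i"]) auto
  then show ?thesis
    by (simp add: hilbert_value_def del: upt_Suc)
qed

lemma hilbert_value_le_one:
  "hilbert_value scale (map y [n..<n + Suc m]) \<le> 1"
proof (cases "\<exists>i\<le>m. y (n + i) = 0")
  case True
  then show ?thesis
    using hilbert_value_zero zero_least by metis
next
  case False
  then have nz: "y (n + i) \<noteq> 0" if "i \<le> m" for i
    using that by blast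
  have "y n \<noteq> 0"
    using nz[of 0] by simp
  have "hilbert_value scale (map y [n..<n + Suc m]) =
      (\<Prod>i<m. y (n + i) \<oslash> y (n + Suc i)) * (y (n + m) \<oslash> y n)"
    using nz by (rule hilbert_value_window)
  also have "\<dots> \<le> (y n \<oslash> y (n + m)) * (y (n + m) \<oslash> y n)"
    using prod_quotient_le[of m "\<lambda>i. y (n + i)"] nz
    by (intro semiring_mult_right_mono) simp
  also have "\<dots> \<le> y n \<oslash> y n"
    using \<open>y n \<noteq> 0\<close> nz by (intro quotient_mult_le) auto
  also have "\<dots> \<le> 1"
    using \<open>y n \<noteq> 0\<close> by (rule quotient_self_le_one)
  finally show ?thesis .
qed

text \<open>Cyclic numbering enters only through \<open>W\<close>, which contains the first vector
  of the window and receives the new one. Vectors may be zero, so degenerate windows are split off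
  first.\<close>

lemma hilbert_value_shift_le:
  assumes W: "b_subsemimodule scale W" "y n \<in> W"
    and y: "y (n + Suc m) = projector W (y (n + m))"
  shows "hilbert_value scale (map y [n..<n + Suc m])
    \<le> hilbert_value scale (map y [Suc n..<Suc n + Suc m])"
proof (cases "\<exists>i\<le>m. y (n + i) = 0")
  case True
  then show ?thesis
    using hilbert_value_zero zero_least by metis
next
  case False
  then have nz: "y (n + i) \<noteq> 0" if "i \<le> m" for i
    using that by blast
  have n0: "y n \<noteq> 0"
    using nz[of 0] by simp
  have proj: "y (n + m) \<oslash> y n \<le> y (n + Suc m) \<oslash> y n"
    unfolding y using W n0 by (rule quotient_le_quotient_projector)
  have window: "hilbert_value scale (map y [n..<n + Suc m]) =
      (\<Prod>i<m. y (n + i) \<oslash> y (n + Suc i)) * (y (n + m) \<oslash> y n)"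
    using nz by (rule hilbert_value_window)
  show ?thesis
  proof (cases "y (n + Suc m) = 0")
    case True
    \<comment> \<open>The next window now has value \<open>0\<close>, so the current one has to
      vanish as well; its closing factor does.\<close>
    then have "y (n + m) \<oslash> y n = 0"
      using proj quotient_zero[OF n0] le_zero_imp_eq by simp
    then show ?thesis
      using window zero_least by (simp del: upt_Suc)
  next
    case last: False
    have nz': "y (Suc n + i) \<noteq> 0" if "i \<le> m" for i
      using nz[of "Suc i"] last that by (cases "i = m") auto
    have window': "hilbert_value scale (map y [Suc n..<Suc n + Suc m]) =
        (\<Prod>i<m. y (Suc n + i) \<oslash> y (Suc n + Suc i)) * (y (Suc n + m) \<oslash> y (Suc n))"
      using nz' by (rule hilbert_value_window)
    show ?thesis
    proof (cases m)
      case 0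
      \<comment> \<open>Both windows are single self-quotients: the new one is at least
        \<open>1\<close>, the old one at most \<open>1\<close>.\<close>
      have "1 \<le> hilbert_value scale (map y [Suc n..<Suc n + Suc m])"
        unfolding window' using last by (simp add: 0 one_le_quotient)
      then show ?thesis
        using hilbert_value_le_one order_trans by blast
    next
      case (Suc p)
      \<comment> \<open>\<open>c\<close> collects the factors common to both windows. Outside it
        each window has its closing factor and one more: \<open>y n \<oslash> y (Suc n)\<close> in
        the old, \<open>y (n + m) \<oslash> y (n + Suc m)\<close> in the new.\<close>
      define c where "c = (\<Prod>i<p. y (Suc n + i) \<oslash> y (Suc n + Suc i))"
      have "hilbert_value scale (map y [n..<n + Suc m]) =
          c * ((y (n + m) \<oslash> y n) * (y n \<oslash> y (Suc n)))"
        unfolding window c_def unfolding Suc prod.lessThan_Suc_shift by (simp add: ac_simps)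
      also have "\<dots> \<le> c * ((y (n + Suc m) \<oslash> y n) * (y n \<oslash> y (Suc n)))"
        by (intro semiring_mult_left_mono semiring_mult_right_mono proj)
      \<comment> \<open>The explicit \<open>1\<close> holds the place of
        \<open>y (n + m) \<oslash> y (n + Suc m)\<close>, which is at least \<open>1\<close> because
        a projection lies below its argument.\<close>
      also have "\<dots> \<le> c * (1 * (y (n + Suc m) \<oslash> y (Suc n)))"
        using n0 nz'[of 0] by (auto intro!: semiring_mult_left_mono quotient_mult_le)
      also have "\<dots> \<le> c * ((y (n + m) \<oslash> y (n + Suc m)) * (y (n + Suc m) \<oslash> y (Suc n)))"
        using projector_le[OF W(1), of "y (n + m)"] last
        by (intro semiring_mult_left_mono semiring_mult_right_mono one_le_quotient)
          (simp_all flip: y)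
      also have "\<dots> = hilbert_value scale (map y [Suc n..<Suc n + Suc m])"
        unfolding window' c_def unfolding Suc by (simp add: ac_simps)
      finally show ?thesis .
    qed
  qed
qed

end

section \<open>Monotonicity and the bound for the cyclic orbit\<close>

theorem theorem15:
  fixes scale :: "'k::idempotent_semifield \<Rightarrow> 'v::idempotent_comm_monoid_add \<Rightarrow> 'v"
    and V :: "nat \<Rightarrow> 'v set"
    and x :: "nat \<Rightarrow> 'v"
    and k :: nat
  assumes A0: "b_complete_semimodule scale"
    and A1: "\<forall>u v. v \<noteq> 0 \<longrightarrow> bdd_above {a. scale a v \<le> u}"
    and k: "k \<ge> 1"
    and sub: "\<forall>i\<in>{1..k}. b_subsemimodule scale (V i)"
    and cyclic: "\<forall>i\<ge>1. V (i + k) = V i"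
    and x1: "x 1 \<in> V 1"
    and step: "\<forall>i\<ge>2. x i = projector (V i) (x (i - 1))"
  shows "mono (\<lambda>l. hilbert_value scale (map x [l + 1..<l + k + 1])) \<and>
    (\<forall>l. hilbert_value scale (map x [1..<k + 1])
            \<le> hilbert_value scale (map x [l + 1..<l + k + 1]) \<and>
         hilbert_value scale (map x [l + 1..<l + k + 1]) \<le> 1)"
proof -
  interpret archimedean_b_complete_semimodule scale
    using A0 A1 by (simp add: archimedean_b_complete_semimodule_def
        archimedean_b_complete_semimodule_axioms_def)
  obtain m where m: "k = Suc m"
    using k by (cases k) auto
  \<comment> \<open>The hypothesis covers one period; descent by \<open>k\<close> reaches the other
    indices.\<close>
  have V: "b_subsemimodule scale (V i)" if "i \<ge> 1" for i
    using that
  proof (induction i rule: less_induct)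
    case (less i)
    show ?case
    proof (cases "i \<le> k")
      case True
      then show ?thesis
        using sub less.prems by simp
    next
      case False
      then have "V i = V (i - k)"
        using cyclic[rule_format, of "i - k"] by simp
      then show ?thesis
        using less.IH[of "i - k"] False k by simp
    qed
  qed
  have x_in: "x i \<in> V i" if "i \<ge> 1" for i
  proof (cases "i = 1")
    case False
    then have "x i = projector (V i) (x (i - 1))"
      using step that by simp
    then show ?thesis
      using projector_in[OF V[OF that]] by simp
  qed (use x1 in simp)
  let ?H = "\<lambda>l. hilbert_value scale (map x [l + 1..<l + k + 1])"
  have "?H l \<le> ?H (Suc l)" for l
  proof -
    \<comment> \<open>By cyclicity the projection \<open>k\<close> steps later is onto the
      subsemimodule that contains \<open>x (l + 1)\<close>.\<close>
    have "x (l + 1 + Suc m) = projector (V (l + 1)) (x (l + 1 + m))"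
      using step[rule_format, of "l + 1 + k"] cyclic[rule_format, of "l + 1"] m by simp
    then have "hilbert_value scale (map x [l + 1..<l + 1 + Suc m])
        \<le> hilbert_value scale (map x [Suc (l + 1)..<Suc (l + 1) + Suc m])"
      using V x_in by (intro hilbert_value_shift_le[of "V (l + 1)"]) auto
    then show ?thesis
      by (simp add: m del: upt_Suc)
  qed
  then have mono: "mono ?H"
    by (rule mono_iff_le_Suc[THEN iffD2, rule_format])
  moreover have "?H 0 \<le> ?H l" for l
    using mono by (rule monoD) simp
  moreover have "?H l \<le> 1" for l
    using hilbert_value_le_one[of x "l + 1" m] by (simp add: m del: upt_Suc)
  ultimately show ?thesis
    by simp
qed

end
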